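(* Let $\tau\in\mathbb{R}\setminus\{0,-1,-2,\dots\}$ and let $\hat P=P\Delta^{(\tau)}$ be the product of the Pascal matrix and the fractional difference matrix of order $\tau$. For every $1\le p\le\infty$ the sequence space $\ell_p(\hat P)$ is linearly isomorphic to $\ell_p$ (in particular $\ell_\infty(\hat P)$ is linearly isomorphic to $\ell_\infty$).
   Context: $\omega$ denotes the space of all (real or complex) sequences $x=(x_k)_{k\ge 0}$. For real $a$ and integer $m\ge 0$, the expression $\frac{\Gamma(a+1)}{m!\,\Gamma(a-m+1)}$ is understood as the generalized binomial coefficient $\frac{a(a-1)\cdots(a-m+1)}{m!}$ (equal to $1$ for $m=0$). The matrix $\hat P=(\hat p_{nk})_{n,k\ge0}=P\Delta^{(\tau)}$ is lower triangular with $$\hat p_{nk}=\sum_{i=k}^{n}(-1)^{i-k}\binom{n}{n-i}\frac{\Gamma(\tau+1)}{(i-k)!\,\Gamma(\tau-i+k+1)}\quad(0\le k\le n),\qquad \hat p_{nk}=0\quad (k>n).$$ It is the product of the Pascal matrix $P=(\binom{n}{n-k})_{0\le k\le n}$ and the lower triangular matrix $\Delta^{(\tau)}$ with entries $(-1)^{n-k}\frac{\Gamma(\tau+1)}{(n-k)!\,\Gamma(\tau-n+k+1)}$ for $0\le k\le n$. For $x\in\omega$, $(\hat P x)_n=\sum_{k=0}^n\hat p_{nk}x_k$. For $1\le p\le\infty$, $\ell_p(\hat P)=\{x\in\omega:\hat P x\in\ell_p\}$, normed by $\|x\|_{\ell_p(\hat P)}=\|\hat P x\|_{\ell_p}$.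 Two spaces are linearly isomorphic if there is a linear bijection between them. *)

theory Defs
  imports "HOL-Analysis.Analysis" "HOL-Library.Function_Algebras"
begin

section \<open>Infinite lower triangular matrices\<close>

definition pascal :: "nat \<Rightarrow> nat \<Rightarrow> real" where
  "pascal n k = (if k \<le> n then of_nat (n choose (n - k)) else 0)"

text \<open>
  The quotient \<open>\<Gamma>(\<tau>+1) / (m! \<Gamma>(\<tau>-m+1))\<close> is read as the generalized binomial coefficient
  \<open>\<tau> gchoose m = \<tau>(\<tau>-1)\<dots>(\<tau>-m+1) / m!\<close>, which avoids the poles of \<open>\<Gamma>\<close>.
\<close>

definition frac_diff :: "real \<Rightarrow> nat \<Rightarrow> nat \<Rightarrow> real" where
  "frac_diff \<tau> n k = (if k \<le> n then (-1) ^ (n - k) * (\<tau> gchoose (n - k)) else 0)"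

text \<open>Since rows are supported on \<open>{..n}\<close>, all sums over the column index stop at \<open>n\<close>.\<close>

definition tri_mult :: "(nat \<Rightarrow> nat \<Rightarrow> real) \<Rightarrow> (nat \<Rightarrow> nat \<Rightarrow> real) \<Rightarrow> nat \<Rightarrow> nat \<Rightarrow> real" where
  "tri_mult A B n k = (\<Sum>i\<le>n. A n i * B i k)"

definition tri_apply ::
  "(nat \<Rightarrow> nat \<Rightarrow> real) \<Rightarrow> (nat \<Rightarrow> 'a) \<Rightarrow> nat \<Rightarrow> 'a::real_normed_field" where
  "tri_apply A x n = (\<Sum>k\<le>n. of_real (A n k) * x k)"

definition P_hat :: "real \<Rightarrow> nat \<Rightarrow> nat \<Rightarrow> real" where
  "P_hat \<tau> = tri_mult pascal (frac_diff \<tau>)"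

lemma P_hat_entry:
  "P_hat \<tau> n k = (\<Sum>i=k..n. (-1) ^ (i - k) * of_nat (n choose (n - i)) * (\<tau> gchoose (i - k)))"
proof -
  have "(\<Sum>i\<le>n. pascal n i * frac_diff \<tau> i k) = (\<Sum>i=k..n. pascal n i * frac_diff \<tau> i k)"
    by (rule sum.mono_neutral_right) (auto simp: frac_diff_def)
  also have "\<dots> = (\<Sum>i=k..n. (-1) ^ (i - k) * of_nat (n choose (n - i)) * (\<tau> gchoose (i - k)))"
    by (rule sum.cong) (auto simp: frac_diff_def pascal_def)
  finally show ?thesis
    by (simp add: P_hat_def tri_mult_def)
qed

lemma P_hat_upper: "k > n \<Longrightarrow> P_hat \<tau> n k = 0"
  by (simp add: P_hat_entry)

section \<open>Sequence spaces\<close>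

text \<open>
  The scalar field \<open>'a\<close> is meant to be \<open>real\<close> or \<open>complex\<close>; spaces of sequences are subsets of
  \<open>nat \<Rightarrow> 'a\<close> with pointwise operations. The exponent ranges over \<open>1 \<le> p \<le> \<infinity>\<close>.
\<close>

definition lp :: "ereal \<Rightarrow> (nat \<Rightarrow> 'a::real_normed_field) set" where
  "lp p = (if p = \<infinity> then {x. bounded (range x)}
           else {x. summable (\<lambda>k. norm (x k) powr real_of_ereal p)})"

definition lp_hat :: "real \<Rightarrow> ereal \<Rightarrow> (nat \<Rightarrow> 'a::real_normed_field) set" where
  "lp_hat \<tau> p = {x. tri_apply (P_hat \<tau>) x \<in> lp p}"

definition seq_scale :: "'a::field \<Rightarrow> (nat \<Rightarrow> 'a) \<Rightarrow> nat \<Rightarrow> 'a" where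
  "seq_scale c x = (\<lambda>k. c * x k)"

interpretation seq: vector_space seq_scale
  by unfold_locales (auto simp: seq_scale_def algebra_simps fun_eq_iff)

lemma subspace_lp:
  assumes "1 \<le> p"
  shows "seq.subspace (lp p :: (nat \<Rightarrow> 'a::real_normed_field) set)"
proof (cases "p = \<infinity>")
  case True
  have "bounded (range (x + y))" if "bounded (range x)" "bounded (range y)" for x y :: "nat \<Rightarrow> 'a"
    using bounded_plus_comp[OF that] by (simp add: plus_fun_def)
  moreover have "bounded (range (seq_scale c x))" if "bounded (range x)" for c and x :: "nat \<Rightarrow> 'a"
  proof -
    from that obtain B where "\<And>k. norm (x k) \<le> B" by (auto simp: bounded_iff)
    then have "norm (seq_scale c x k) \<le> norm c * B" for k
      by (simp add: seq_scale_def norm_mult mult_left_mono)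
    then show ?thesis by (auto simp: bounded_iff)
  qed
  ultimately show ?thesis
    using True by (auto simp: seq.subspace_def lp_def zero_fun_def image_constant_conv)
next
  case False
  define q where "q = real_of_ereal p"
  have q: "q \<ge> 1"
    using assms False by (cases p) (auto simp: q_def)
  have "summable (\<lambda>k. norm ((x + y) k) powr q)"
    if x: "summable (\<lambda>k. norm (x k) powr q)" and y: "summable (\<lambda>k. norm (y k) powr q)"
    for x y :: "nat \<Rightarrow> 'a"
  proof (rule summable_comparison_test')
    show "summable (\<lambda>k. 2 powr q * (norm (x k) powr q + norm (y k) powr q))"
      by (intro summable_mult summable_add x y)
    fix k :: nat
    let ?m = "max (norm (x k)) (norm (y k))"
    have "norm ((x + y) k) \<le> 2 * ?m"
      using norm_triangle_ineq[of "x k" "y k"] by (simp add: plus_fun_def)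
    then have "norm ((x + y) k) powr q \<le> (2 * ?m) powr q"
      using q by (intro powr_mono2) auto
    also have "\<dots> = 2 powr q * ?m powr q"
      by (simp add: powr_mult)
    also have "\<dots> \<le> 2 powr q * (norm (x k) powr q + norm (y k) powr q)"
      by (intro mult_left_mono) (auto simp: max_def)
    finally show "norm (norm ((x + y) k) powr q)
        \<le> 2 powr q * (norm (x k) powr q + norm (y k) powr q)"
      by simp
  qed
  moreover have "summable (\<lambda>k. norm (seq_scale c x k) powr q)"
    if "summable (\<lambda>k. norm (x k) powr q)" for c and x :: "nat \<Rightarrow> 'a"
    using summable_mult[OF that, of "norm c powr q"]
    by (simp add: seq_scale_def norm_mult powr_mult)
  ultimately show ?thesis
    using False by (auto simp: seq.subspace_def lp_def q_def)
qed

lemma subspace_lp_hat: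
  assumes "1 \<le> p"
  shows "seq.subspace (lp_hat \<tau> p :: (nat \<Rightarrow> 'a::real_normed_field) set)"
proof -
  have "tri_apply A 0 = (0 :: nat \<Rightarrow> 'a)"
    "tri_apply A (x + y) = tri_apply A x + tri_apply A y"
    "tri_apply A (seq_scale c x) = seq_scale c (tri_apply A x)" for A c and x y :: "nat \<Rightarrow> 'a"
    by (auto simp: tri_apply_def seq_scale_def fun_eq_iff algebra_simps sum.distrib sum_distrib_left)
  then show ?thesis
    using subspace_lp[OF assms, where 'a = 'a] by (auto simp: seq.subspace_def lp_hat_def)
qed

definition linearly_isomorphic :: "(nat \<Rightarrow> 'a::field) set \<Rightarrow> (nat \<Rightarrow> 'a) set \<Rightarrow> bool" where
  "linearly_isomorphic V W \<longleftrightarrow>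
     (\<exists>f. bij_betw f V W \<and>
          (\<forall>x\<in>V. \<forall>y\<in>V. f (x + y) = f x + f y) \<and>
          (\<forall>c. \<forall>x\<in>V. f (seq_scale c x) = seq_scale c (f x)))"

end

theory Submission
  imports Defs
begin

text \<open>
  All diagonal entries of \<open>P_hat \<tau>\<close> equal 1, so forward substitution shows that the matrix acts
  bijectively on the space of all sequences. Since \<open>lp_hat \<tau> p\<close> is the preimage of \<open>lp p\<close> under
  this linear action, the action itself restricts to the required isomorphism.
\<close>

lemma tri_apply_add: "tri_apply A (x + y) = tri_apply A x + tri_apply A y"
  by (simp add: tri_apply_def fun_eq_iff distrib_left sum.distrib)

lemma tri_apply_scale: "tri_apply A (seq_scale c x) = seq_scale c (tri_apply A x)"
  by (simp add: tri_apply_def seq_scale_def fun_eq_iff sum_distrib_left mult.left_commute)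

text \<open>Isolates the diagonal term, the only place where \<open>x n\<close> enters row
  \<open>n\<close>, so that the row can be solved for it.\<close>

lemma tri_apply_split_diag:
  "tri_apply A x n = (\<Sum>k<n. of_real (A n k) * x k) + of_real (A n n) * x n"
  by (simp add: tri_apply_def flip: lessThan_Suc_atMost)

text \<open>Forward substitution; it terminates because the sum only calls indices
  \<open>k < n\<close>. The equation is unconditional and would loop as a simp rule.\<close>

fun tri_solve ::
  "(nat \<Rightarrow> nat \<Rightarrow> real) \<Rightarrow> (nat \<Rightarrow> 'a) \<Rightarrow> nat \<Rightarrow> 'a::real_normed_field" where
  "tri_solve A y n = (y n - (\<Sum>k<n. of_real (A n k) * tri_solve A y k)) / of_real (A n n)"

declare tri_solve.simps [simp del]

lemma tri_apply_tri_solve: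
  assumes "\<And>n. A n n \<noteq> 0"
  shows "tri_apply A (tri_solve A y) = y"
proof
  fix n
  show "tri_apply A (tri_solve A y) n = y n"
    using assms[of n] by (simp add: tri_apply_split_diag tri_solve.simps[of A y n])
qed

lemma tri_solve_tri_apply:
  assumes "\<And>n. A n n \<noteq> 0"
  shows "tri_solve A (tri_apply A x) = x"
proof
  fix n
  show "tri_solve A (tri_apply A x) n = x n"
  proof (induction n rule: less_induct)
    case (less n)
    \<comment> \<open>Once the earlier entries are recovered, this sum cancels against row
      \<open>n\<close>, leaving \<open>A n n * x n\<close> to be divided by
      \<open>A n n\<close>.\<close>
    then have "(\<Sum>k<n. of_real (A n k) * tri_solve A (tri_apply A x) k)
        = (\<Sum>k<n. of_real (A n k) * x k)"
      by (intro sum.cong) auto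
    then show ?case
      using assms[of n] by (simp add: tri_solve.simps[of A _ n] tri_apply_split_diag[of A x n])
  qed
qed

lemma bij_tri_apply:
  assumes "\<And>n. A n n \<noteq> 0"
  shows "bij (tri_apply A :: (nat \<Rightarrow> 'a::real_normed_field) \<Rightarrow> _)"
  using assms by (intro o_bij[of "tri_solve A"])
    (auto simp: fun_eq_iff tri_apply_tri_solve tri_solve_tri_apply)

text \<open>Only \<open>i = n\<close> remains in the sum, and both binomial coefficients there have
  lower index 0.\<close>

lemma P_hat_diag: "P_hat \<tau> n n = 1"
  by (simp add: P_hat_entry)

lemma linearly_isomorphic_lp_hat_lp:
  "linearly_isomorphic (lp_hat \<tau> p :: (nat \<Rightarrow> 'a::real_normed_field) set) (lp p)"
proof -
  let ?f = "tri_apply (P_hat \<tau>) :: (nat \<Rightarrow> 'a) \<Rightarrow> _"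
  have bij: "bij ?f"
    by (rule bij_tri_apply) (simp add: P_hat_diag)
  have "lp_hat \<tau> p = ?f -` lp p"
    by (auto simp: lp_hat_def)
  \<comment> \<open>Surjectivity on all sequences makes the image of the preimage the whole of
    \<open>lp p\<close>.\<close>
  then have "?f ` lp_hat \<tau> p = lp p"
    using bij by (simp add: bij_is_surj surj_image_vimage_eq)
  then have "bij_betw ?f (lp_hat \<tau> p) (lp p)"
    using bij by (metis bij_betw_def bij_is_inj inj_on_subset subset_UNIV)
  then show ?thesis
    unfolding linearly_isomorphic_def
    by (intro exI[of _ ?f]) (simp add: tri_apply_add tri_apply_scale)
qed

theorem theorem3p2:
  fixes \<tau> :: real and p :: ereal
  assumes "\<tau> \<notin> \<int>\<^sub>\<le>\<^sub>0" and "1 \<le> p"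
  shows "linearly_isomorphic (lp_hat \<tau> p :: (nat \<Rightarrow> real) set) (lp p) \<and>
         linearly_isomorphic (lp_hat \<tau> p :: (nat \<Rightarrow> complex) set) (lp p)"
  by (simp add: linearly_isomorphic_lp_hat_lp)

end
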